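(* Let $m$ be a positive integer, $q=2^m$, and let $\gamma\in\mathbb{F}_{q^2}$ be such that either $\gamma\in\mathbb{F}_q$, or $m$ is odd and $\operatorname{Tr}_q^{q^2}(\gamma)=1$. Then the compositional inverse of the permutation polynomial $f_4(x)=x+\gamma\operatorname{Tr}_{q}^{q^2}(x^2+x^3+x^{q+2})$ over $\mathbb{F}_{q^2}$ is $$f_4^{-1}(x)=\begin{cases}x+\gamma(\operatorname{Tr}_{q}^{q^2}(x))^2+\gamma(\operatorname{Tr}_{q}^{q^2}(x))^3, & \text{if } \gamma\in\mathbb{F}_q,\\ \operatorname{Tr}_{q}^{q^2}((1+\gamma)x)+\gamma\left[(\operatorname{Tr}_{q}^{q^2}(x)+1)^t+1\right], & \text{if } \operatorname{Tr}_{q}^{q^2}(\gamma)=1 \text{ and } m \text{ is odd},\end{cases}$$ where $t$ is a positive integer with $3t\equiv 1 \pmod{2^m-1}$.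
   Context: $\mathbb{F}_{q^2}$ is the finite field with $q^2$ elements and $\mathbb{F}_q$ its subfield with $q$ elements. $\operatorname{Tr}_q^{q^2}(z)=z+z^q$ for $z\in\mathbb{F}_{q^2}$. A polynomial $f\in\mathbb{F}_{q^2}[x]$ is a permutation polynomial over $\mathbb{F}_{q^2}$ if the map $a\mapsto f(a)$ is a bijection of $\mathbb{F}_{q^2}$. Its compositional inverse $f^{-1}$ is the polynomial $g$ (polynomials being identified with the maps $\mathbb{F}_{q^2}\to\mathbb{F}_{q^2}$ they induce) such that $f(g(x))=g(f(x))=x$ for every $x\in\mathbb{F}_{q^2}$. The integer $t$ is used only in the second case, where $m$ is odd and hence $\gcd(3,2^m-1)=1$. *)

theory Defs
  imports "HOL-Computational_Algebra.Polynomial" "HOL-Number_Theory.Cong"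
begin

definition is_subfield :: "'a::field set \<Rightarrow> bool" where
  "is_subfield K \<longleftrightarrow> 0 \<in> K \<and> 1 \<in> K \<and>
     (\<forall>x\<in>K. \<forall>y\<in>K. x + y \<in> K \<and> x * y \<in> K) \<and>
     (\<forall>x\<in>K. - x \<in> K \<and> inverse x \<in> K)"

(* Polymorphic so that it applies both to elements z of the field with q^2
   elements and, as in f_4, to polynomials h over it; in the latter case
   poly (Tr q h) a = Tr q (poly h a). *)
definition Tr :: "nat \<Rightarrow> 'b::semiring_1 \<Rightarrow> 'b" where
  "Tr q z = z + z ^ q"

definition permutation_poly :: "'a::field poly \<Rightarrow> bool" where
  "permutation_poly f \<longleftrightarrow> bij (poly f)"

(* "g is the compositional inverse of f". Over a finite field polynomials are
   identified with the maps they induce, so g is determined by this property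
   up to that identification. *)
definition comp_inverse :: "'a::field poly \<Rightarrow> 'a poly \<Rightarrow> bool" where
  "comp_inverse f g \<longleftrightarrow> (\<forall>x. poly f (poly g x) = x \<and> poly g (poly f x) = x)"

abbreviation X :: "'a::field poly" where
  "X \<equiv> [:0, 1:]"

definition f4 :: "nat \<Rightarrow> 'a::field \<Rightarrow> 'a poly" where
  "f4 q \<gamma> = X + smult \<gamma> (Tr q (X ^ 2 + X ^ 3 + X ^ (q + 2)))"

end

theory Submission
  imports Defs
begin

text \<open>
  Write \<open>T = x + x ^ q\<close> for the trace of \<open>x\<close>; it is fixed by \<open>a \<mapsto> a ^ q\<close>. In characteristic two
  the binomial coefficient 3 equals 1, so the trace occurring in \<^term>\<open>f4 q \<gamma>\<close> collapses:
  the trace of \<open>x\<^sup>2 + x\<^sup>3 + x ^ (q + 2)\<close> is \<open>T\<^sup>2 + T\<^sup>3\<close>. Hence \<open>f4\<close> induces the map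
  \<open>x \<mapsto> x + \<gamma> * (T\<^sup>2 + T\<^sup>3)\<close>, which moves \<open>x\<close> by an amount depending on \<open>T\<close> only. It is inverted as
  soon as \<open>T\<close> can be recovered from the trace \<open>s\<close> of the image, and
  \<open>s = T + Tr(\<gamma>) * (T\<^sup>2 + T\<^sup>3)\<close>.

  If \<open>\<gamma>\<close> lies in the subfield with \<open>q\<close> elements, its trace vanishes, so \<open>s = T\<close> and the map is an
  involution. The claimed inverse is the map itself in expanded form.

  If the trace of \<open>\<gamma>\<close> is 1, then \<open>s = T + T\<^sup>2 + T\<^sup>3 = (T + 1)\<^sup>3 + 1\<close>. Cubing is inverted on the subfield
  by the power \<open>t\<close> (\<open>power_cong_one\<close>, applied to elements fixed by \<open>a \<mapsto> a ^ q\<close>), so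
  \<open>T = (s + 1) ^ t + 1\<close>. Substituting this in
  \<open>x = f(x) + \<gamma> * (T\<^sup>2 + T\<^sup>3) = f(x) + \<gamma> * (s + T)\<close> gives the claimed formula, because
  the trace of \<open>(1 + \<gamma>) * y\<close> is \<open>y + \<gamma> * Tr(y)\<close> for such \<open>\<gamma>\<close>.

  From field theory, \<open>subfield_power_card\<close> gives \<open>a ^ q = a\<close> on the subfield and
  \<open>a ^ (q\<^sup>2) = a\<close> everywhere, the latter being what makes traces fixed by \<open>a \<mapsto> a ^ q\<close>; it also forces
  characteristic two, which makes that map additive.

  Since the field is finite, a left inverse is automatically two-sided and its existence shows that
  \<open>f4\<close> is a permutation polynomial.
\<close>

text \<open>Lagrange's theorem for the unit group, by the usual trick: multiplication by a nonzero \<open>a\<close>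
  permutes the nonzero elements, so comparing their product before and after gives
  \<open>a ^ (card K - 1) = 1\<close>.\<close>

lemma subfield_power_card:
  fixes K :: "'a::field set"
  assumes K: "is_subfield K" and fin: "finite K" and a: "a \<in> K"
  shows "a ^ card K = a"
proof (cases "a = 0")
  case True
  then show ?thesis
    using fin a by (auto simp: card_gt_0_iff power_0_left)
next
  case False
  let ?U = "K - {0}"
  have finU: "finite ?U"
    using fin by simp
  have "inj_on ((*) a) ?U"
    using False by (auto simp: inj_on_def)
  moreover have "(*) a ` ?U \<subseteq> ?U"
    using K a False by (auto simp: is_subfield_def)
  ultimately have "bij_betw ((*) a) ?U ?U"
    using finU by (simp add: bij_betw_def endo_inj_surj)
  then have "\<Prod>?U = (\<Prod>x\<in>?U. a * x)"
    using prod.reindex_bij_betw[of "(*) a" ?U ?U "\<lambda>x. x"] by simp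
  also have "\<dots> = a ^ card ?U * \<Prod>?U"
    by (simp add: prod.distrib)
  finally have "a ^ card ?U = 1"
    using finU by simp
  moreover have "card K = Suc (card ?U)"
    using K fin card.remove[of K 0] by (simp add: is_subfield_def)
  ultimately show ?thesis
    by simp
qed

lemma power_card_UNIV:
  fixes x :: "'a::{finite,field}"
  shows "x ^ card (UNIV :: 'a set) = x"
  by (rule subfield_power_card) (auto simp: is_subfield_def)

text \<open>Raising \<open>-1\<close> to the even cardinality of the field gives both \<open>-1\<close> and 1.\<close>

lemma even_card_imp_char_two:
  assumes "even (card (UNIV :: 'a::{finite,field} set))"
  shows "(2 :: 'a) = 0"
proof -
  have "(-1 :: 'a) ^ card (UNIV :: 'a set) = 1"
    using assms by simp
  then show ?thesis
    using power_card_UNIV[of "-1 :: 'a"] by (metis add.right_inverse one_add_one)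
qed

lemma power_two_power_add:
  fixes x y :: "'a::comm_ring_1"
  assumes "(2 :: 'a) = 0"
  shows "(x + y) ^ (2 ^ n) = x ^ (2 ^ n) + y ^ (2 ^ n)"
proof (induction n)
  case 0
  then show ?case by simp
next
  case (Suc n)
  have sq: "(u + v)\<^sup>2 = u\<^sup>2 + v\<^sup>2" for u v :: 'a
    using assms by (simp add: power2_sum)
  have "(x + y) ^ (2 ^ Suc n) = ((x + y) ^ (2 ^ n))\<^sup>2"
    by (simp add: power_mult[symmetric] mult.commute)
  also have "\<dots> = x ^ (2 ^ Suc n) + y ^ (2 ^ Suc n)"
    by (simp add: Suc.IH sq power_mult[symmetric] mult.commute)
  finally show ?case .
qed

lemma poly_Tr: "poly (Tr q h) a = Tr q (poly h a)"
  by (simp add: Tr_def)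

text \<open>The exponent \<open>t\<close> exists for odd \<open>m\<close>: since \<open>2 ^ (m + 1)\<close> is then 1 modulo 3, one third of
  \<open>1 + 2 * (2 ^ m - 1) = 2 ^ (m + 1) - 1\<close> is an integer.\<close>

lemma inverse_of_three_exists:
  assumes "odd m"
  obtains t :: nat where "t > 0" "[3 * t = 1] (mod (2 ^ m - 1))"
proof -
  obtain k where k: "m = 2 * k + 1"
    using assms by (elim oddE)
  have "[(4 :: nat) ^ Suc k = 1 ^ Suc k] (mod 3)"
    by (rule cong_pow) (simp add: cong_def)
  then have "3 dvd (4 :: nat) ^ Suc k - 1"
    by (metis cong_to_1_nat power_one)
  moreover have "(2 :: nat) ^ Suc m = 4 ^ Suc k"
    by (simp add: k power_mult)
  ultimately obtain t where t: "(2 :: nat) ^ Suc m - 1 = 3 * t"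
    by (metis dvdE)
  have eq: "3 * t = 1 + 2 * (2 ^ m - 1)"
  proof -
    have "(2 :: nat) ^ m \<ge> 1" by simp
    then show ?thesis using t unfolding power_Suc by linarith
  qed
  show thesis
  proof
    show "t > 0" using eq by presburger
    show "[3 * t = 1] (mod (2 ^ m - 1))"
      unfolding eq cong_def by (simp only: mod_mult_self1)
  qed
qed

text \<open>No inverse of \<open>a\<close> is available here, as \<open>a\<close> may be 0: instead of cancelling to \<open>a ^ (q - 1) = 1\<close>,
  one factor \<open>a\<close> is kept to absorb each \<open>a ^ (q - 1)\<close>. This is why \<open>n\<close> has to be positive.\<close>

lemma power_cong_one:
  fixes a :: "'a::monoid_mult"
  assumes fix_a: "a ^ q = a" and n: "[n = 1] (mod (q - 1))" and "n > 0" "q > 0"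
  shows "a ^ n = a"
proof -
  have "(q - 1) dvd (n - 1)"
    using n cong_to_1_nat by blast
  then obtain k where "n - 1 = k * (q - 1)"
    by (metis dvdE mult.commute)
  then have "n = 1 + k * (q - 1)"
    using \<open>n > 0\<close> by simp
  moreover have "a ^ (1 + j * (q - 1)) = a" for j
  proof (induction j)
    case (Suc j)
    have "1 + Suc j * (q - 1) = (1 + j * (q - 1)) + (q - 1)"
      by simp
    then have "a ^ (1 + Suc j * (q - 1)) = a * a ^ (q - 1)"
      by (simp only: power_add[of a "1 + j * (q - 1)"] Suc.IH)
    also have "\<dots> = a"
      using fix_a \<open>q > 0\<close> by (metis Suc_diff_1 power_Suc)
    finally show ?case .
  qed simp
  ultimately show ?thesis by simp
qed

lemma permutation_and_comp_inverseI:
  fixes f g :: "'a::{finite,field} poly"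
  assumes left: "\<And>x. poly g (poly f x) = x"
  shows "permutation_poly f" and "comp_inverse f g"
proof -
  have "inj (poly f)"
    using left by (rule inj_on_inverseI)
  then have "bij (poly f)"
    by (simp add: bij_def finite_UNIV_inj_surj)
  then show "permutation_poly f"
    by (simp add: permutation_poly_def)
  show "comp_inverse f g"
    unfolding comp_inverse_def using left \<open>bij (poly f)\<close>
    by (metis bij_pointE)
qed

theorem theorem3p4:
  fixes m q :: nat and K :: "'a::{finite,field} set" and \<gamma> :: 'a
  assumes "m > 0" and "q = 2 ^ m"
    and "card (UNIV :: 'a set) = q ^ 2"
    and "is_subfield K" and "card K = q"
    and "\<gamma> \<in> K \<or> (odd m \<and> Tr q \<gamma> = 1)"
  shows "permutation_poly (f4 q \<gamma>) \<and>
    (\<gamma> \<in> K \<longrightarrow>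
       comp_inverse (f4 q \<gamma>) (X + smult \<gamma> (Tr q X ^ 2) + smult \<gamma> (Tr q X ^ 3))) \<and>
    (Tr q \<gamma> = 1 \<and> odd m \<longrightarrow>
       (\<forall>t::nat. t > 0 \<and> [3 * t = 1] (mod (2 ^ m - 1)) \<longrightarrow>
          comp_inverse (f4 q \<gamma>)
            (Tr q (smult (1 + \<gamma>) X) + smult \<gamma> ((Tr q X + 1) ^ t + 1))))"
proof -
  have two: "(2 :: 'a) = 0"
    using assms(1-3) by (intro even_card_imp_char_two) simp
  have dbl: "a + a = 0" for a :: 'a
    using two by (metis mult_2 mult_zero_left)
  \<comment> \<open>Identities modulo 2 are certified below by naming the even difference \<open>2 * d\<close> of the two sides,
    which leaves a goal that holds in every characteristic.\<close>
  have drop_even: "a = b" if "a = b + 2 * d" for a b d :: 'a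
    using that two by simp
  have add_q: "(a + b) ^ q = a ^ q + b ^ q" for a b :: 'a
    unfolding assms(2) by (rule power_two_power_add[OF two])
  have q_q: "(a ^ q) ^ q = a" for a :: 'a
    using power_card_UNIV[of a] assms(3) by (simp add: power_mult power2_eq_square)
  have Tr_q: "Tr q a ^ q = Tr q a" for a :: 'a
    by (simp add: Tr_def add_q q_q add.commute)
  have Tr_add: "Tr q (a + b) = Tr q a + Tr q b" for a b :: 'a
    by (simp add: Tr_def add_q)
  have Tr_mult: "Tr q (a * c) = Tr q a * c" if "c ^ q = c" for a c :: 'a
    by (simp add: Tr_def power_mult_distrib that distrib_right)

  define c where "c x = Tr q x ^ 2 + Tr q x ^ 3" for x :: 'a
  have c_q: "c x ^ q = c x" for x
    using Tr_q[of x] by (simp add: c_def add_q flip: power_mult) (simp add: mult.commute power_mult)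
  have f4_eq: "poly (f4 q \<gamma>) x = x + \<gamma> * c x" for x
  proof -
    define y where "y = x ^ q"
    have "(x ^ 2 + x ^ 3 + x ^ (q + 2)) ^ q = y ^ 2 + y ^ 3 + x * y ^ 2"
    proof -
      have "(x ^ n) ^ q = y ^ n" for n
        by (simp add: y_def mult.commute flip: power_mult)
      moreover have "(x ^ (q + 2)) ^ q = x * y ^ 2"
        by (simp add: power_add power_mult_distrib q_q y_def mult.commute flip: power_mult)
           (simp add: power_mult q_q power2_eq_square)
      ultimately show ?thesis
        by (simp add: add_q)
    qed
    moreover have "x ^ (q + 2) = y * x ^ 2"
      by (simp add: y_def power_add power2_eq_square)
    ultimately have
      "Tr q (x ^ 2 + x ^ 3 + x ^ (q + 2)) = x ^ 2 + x ^ 3 + y * x ^ 2 + (y ^ 2 + y ^ 3 + x * y ^ 2)"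
      by (simp add: Tr_def)
    also have "\<dots> = c x"
      unfolding c_def Tr_def y_def[symmetric]
      by (rule drop_even[where d = "- (x * y + x ^ 2 * y + x * y ^ 2)"]) algebra
    finally show ?thesis
      by (simp add: f4_def poly_Tr)
  qed
  have Tr_f4: "Tr q (poly (f4 q \<gamma>) x) = Tr q x + Tr q \<gamma> * c x" for x
    by (simp add: f4_eq Tr_add Tr_mult c_q)

  have case1: "poly (X + smult \<gamma> (Tr q X ^ 2) + smult \<gamma> (Tr q X ^ 3)) (poly (f4 q \<gamma>) x) = x"
    if "\<gamma> \<in> K" for x
  proof -
    have "\<gamma> ^ q = \<gamma>"
      using subfield_power_card[OF assms(4) _ that] assms(5) by simp
    then have "Tr q (poly (f4 q \<gamma>) x) = Tr q x"
      using Tr_f4[of x] by (simp add: Tr_def dbl)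
    then have "poly (X + smult \<gamma> (Tr q X ^ 2) + smult \<gamma> (Tr q X ^ 3)) (poly (f4 q \<gamma>) x)
        = poly (f4 q \<gamma>) x + \<gamma> * c x"
      by (simp add: poly_Tr c_def distrib_left add.assoc)
    also have "\<dots> = x"
      unfolding f4_eq by (rule drop_even[where d = "\<gamma> * c x"]) algebra
    finally show ?thesis .
  qed

  have case2: "poly (Tr q (smult (1 + \<gamma>) X) + smult \<gamma> ((Tr q X + 1) ^ t + 1))
      (poly (f4 q \<gamma>) x) = x"
    if Tr\<gamma>: "Tr q \<gamma> = 1" and t: "t > 0" "[3 * t = 1] (mod (2 ^ m - 1))" for t x
  proof -
    define s where "s = Tr q (poly (f4 q \<gamma>) x)"
    have s: "s = Tr q x + c x"
      using Tr_f4[of x] Tr\<gamma> by (simp add: s_def)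
    have "s + 1 = (Tr q x + 1) ^ 3"
      unfolding s c_def by (rule drop_even[where d = "- (Tr q x + Tr q x ^ 2)"]) algebra
    then have "(s + 1) ^ t = (Tr q x + 1) ^ (3 * t)"
      by (simp add: power_mult)
    also have "\<dots> = Tr q x + 1"
    proof (rule power_cong_one)
      show "(Tr q x + 1) ^ q = Tr q x + 1"
        unfolding add_q Tr_q by simp
      show "[3 * t = 1] (mod (q - 1))" "3 * t > 0" "q > 0"
        using t unfolding assms(2) by auto
    qed
    finally have root: "(s + 1) ^ t = Tr q x + 1" .
    have Tr_lin: "Tr q ((1 + \<gamma>) * y) = y + \<gamma> * Tr q y" for y
    proof -
      have \<gamma>_q: "\<gamma> ^ q = 1 - \<gamma>"
        using Tr\<gamma> by (simp add: Tr_def eq_diff_eq add.commute)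
      have "Tr q ((1 + \<gamma>) * y) = (1 + \<gamma>) * y + (1 + \<gamma> ^ q) * y ^ q"
        by (simp add: Tr_def power_mult_distrib add_q)
      also have "\<dots> = y + \<gamma> * Tr q y"
        unfolding Tr_def \<gamma>_q
        by (rule drop_even[where d = "(1 - \<gamma>) * y ^ q"]) (simp add: algebra_simps)
      finally show ?thesis .
    qed
    have "poly (Tr q (smult (1 + \<gamma>) X) + smult \<gamma> ((Tr q X + 1) ^ t + 1)) (poly (f4 q \<gamma>) x)
        = poly (f4 q \<gamma>) x + \<gamma> * s + \<gamma> * ((s + 1) ^ t + 1)"
      using Tr_lin[of "poly (f4 q \<gamma>) x"]
      by (simp add: poly_Tr s_def mult.commute)
    also have "\<dots> = x"
      unfolding root unfolding s f4_eq
      by (rule drop_even[where d = "\<gamma> * (Tr q x + c x + 1)"]) algebra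
    finally show ?thesis .
  qed

  have "permutation_poly (f4 q \<gamma>)"
  proof (cases "\<gamma> \<in> K")
    case True
    then show ?thesis
      using permutation_and_comp_inverseI(1) case1 by blast
  next
    case False
    then have "odd m" and "Tr q \<gamma> = 1"
      using assms(6) by auto
    then show ?thesis
      using inverse_of_three_exists permutation_and_comp_inverseI(1) case2 by metis
  qed
  then show ?thesis
    using permutation_and_comp_inverseI(2) case1 case2 by blast
qed

end
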